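(* Let $A\in\mathbb{C}^{n\times n}$ be diagonalizable, $A=V\Lambda V^{-1}$ with $\Lambda$ diagonal and $V=[v_1\cdots v_n]$ invertible. Let $\Omega\subset\{1,\ldots,n\}$ have $K$ elements and let $V_\Omega\in\mathbb{C}^{n\times K}$ be the matrix with columns $\{v_k\}_{k\in\Omega}$. Let $M\subset\{1,\ldots,n\}$ be a set of $m$ sampled vertices, and let $P_M\in\{0,1\}^{m\times n}$ be the restriction operator to $M$. If $x=V_\Omega c$ for some $c\in\mathbb{C}^K$ (that is, $x$ is $\Omega$-bandlimited) and $P_MV_\Omega$ has full column rank $K$, then $x$ is uniquely determined (among $\Omega$-bandlimited signals) by the samples $y=P_Mx$, and it is recovered by $$\hat{c}=(P_MV_\Omega)^\dagger y,\qquad \hat{x}=V_\Omega\hat{c},$$ that is, $\hat{x}=x$.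
   Context: The vertex set of the graph is $\{1,\ldots,n\}$ and a signal is a vector $x\in\mathbb{C}^n$. A signal $x$ is $\Omega$-bandlimited (in the BGFT, i.e. Biorthogonal Graph Fourier Transform, sense) if $x\in\operatorname{span}(V_\Omega)$, the column span of $V_\Omega$, i.e. $x=V_\Omega c$ for some $c\in\mathbb{C}^K$. The restriction operator $P_M$ maps $x\in\mathbb{C}^n$ to the vector $(x_i)_{i\in M}\in\mathbb{C}^m$ of its entries at the vertices in $M$. $B^\dagger$ denotes the Moore–Penrose pseudoinverse of $B$. *)

theory Defs
  imports Complex_Main
    "Jordan_Normal_Form.DL_Rank_Submatrix"
    "Jordan_Normal_Form.Schur_Decomposition"
begin

text \<open>
  The vertices are \<open>{..<n}\<close>, matching the zero-based indices of \<open>'a mat\<close> and \<open>'a vec\<close>.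
  Rows and columns selected by a set are kept in increasing order, which is the convention
  of \<^const>\<open>submatrix\<close>.
\<close>

definition select_cols :: "complex mat \<Rightarrow> nat set \<Rightarrow> complex mat" where
  "select_cols V \<Omega> = submatrix V UNIV \<Omega>"

definition restriction_mat :: "nat \<Rightarrow> nat set \<Rightarrow> complex mat" where
  "restriction_mat n M = submatrix (1\<^sub>m n) M UNIV"

lemma restriction_mat_mult_vec:
  assumes "x \<in> carrier_vec n" "M \<subseteq> {..<n}"
  shows "restriction_mat n M *\<^sub>v x = vec (card M) (\<lambda>i. x $ pick M i)"
proof (rule eq_vecI)
  have M: "{i. i < n \<and> i \<in> M} = M" using assms(2) by auto
  have dims: "dim_row (restriction_mat n M) = card M" "dim_col (restriction_mat n M) = n"
    by (simp_all add: restriction_mat_def dim_submatrix M)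
  show "dim_vec (restriction_mat n M *\<^sub>v x) = dim_vec (vec (card M) (\<lambda>i. x $ pick M i))"
    by (simp add: dims)
  fix i assume "i < dim_vec (vec (card M) (\<lambda>i. x $ pick M i))"
  hence i: "i < card M" by simp
  hence p: "pick M i < n" using pick_in_set[of i M] assms(2) by auto
  have "row (restriction_mat n M) i = row (1\<^sub>m n) (pick M i)"
    unfolding restriction_mat_def by (rule row_submatrix_UNIV) (simp add: M i)
  thus "(restriction_mat n M *\<^sub>v x) $ i = vec (card M) (\<lambda>i. x $ pick M i) $ i"
    using i p assms(1) by (simp add: dims)
qed

definition bandlimited :: "nat \<Rightarrow> complex mat \<Rightarrow> nat set \<Rightarrow> complex vec \<Rightarrow> bool" where
  "bandlimited n V \<Omega> x \<longleftrightarrow> x \<in> vec_space.col_space n (select_cols V \<Omega>)"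

text \<open>The four Penrose conditions, \<^const>\<open>mat_adjoint\<close> being the conjugate transpose.\<close>

definition is_pseudoinverse :: "complex mat \<Rightarrow> complex mat \<Rightarrow> bool" where
  "is_pseudoinverse B X \<longleftrightarrow>
     X \<in> carrier_mat (dim_col B) (dim_row B) \<and>
     B * X * B = B \<and>
     X * B * X = X \<and>
     mat_adjoint (B * X) = B * X \<and>
     mat_adjoint (X * B) = X * B"

definition pseudoinverse :: "complex mat \<Rightarrow> complex mat" where
  "pseudoinverse B = (THE X. is_pseudoinverse B X)"

end

theory Submission
  imports Defs
begin

text \<open>
  Write \<open>B = P\<^sub>M V\<^sub>\<Omega>\<close>, so that the samples of \<open>V\<^sub>\<Omega> c\<close> are \<open>B c\<close>. Full column rank makes \<open>c \<mapsto> B c\<close>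
  injective: two bandlimited signals with the same samples have the same coefficients and hence
  coincide.

  For the recovery formula it suffices that \<open>B\<^sup>\<dagger>\<close> satisfies the single Penrose equation
  \<open>B B\<^sup>\<dagger> B = B\<close>: then \<open>B (B\<^sup>\<dagger> y) = B B\<^sup>\<dagger> B c = B c\<close>, and injectivity gives \<open>B\<^sup>\<dagger> y = c\<close>. The pseudoinverse
  is defined by a definite description, so its Penrose equations become available only once
  it is known that exactly one matrix satisfies them. Uniqueness is a general computation with adjoints
  (\<open>is_pseudoinverse_unique\<close>). Existence comes from the normal equations: the Gram matrix \<open>B\<^sup>* B\<close> is
  invertible because \<open>B\<^sup>* B v = 0\<close> forces \<open>\<parallel>B v\<parallel>\<^sup>2 = 0\<close>, and \<open>(B\<^sup>* B)\<^sup>-\<^sup>1 B\<^sup>*\<close> is the pseudoinverse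
  (\<open>is_pseudoinverse_normal_equations\<close>).
\<close>

section \<open>The adjoint of a matrix\<close>

lemma mat_adjoint_carrier:
  assumes "B \<in> carrier_mat nr nc"
  shows "mat_adjoint B \<in> carrier_mat nc nr"
  using assms by (auto simp: mat_adjoint_def mat_of_rows_def)

lemma mat_adjoint_index:
  assumes "i < dim_col B" "j < dim_row B"
  shows "mat_adjoint B $$ (i, j) = conjugate (B $$ (j, i))"
  using assms by (simp add: mat_adjoint_def mat_of_rows_index)

lemma mat_adjoint_adjoint: "mat_adjoint (mat_adjoint B) = B"
proof (rule eq_matI)
  have d: "mat_adjoint B \<in> carrier_mat (dim_col B) (dim_row B)"
    by (rule mat_adjoint_carrier) simp
  show dims: "dim_row (mat_adjoint (mat_adjoint B)) = dim_row B"
    "dim_col (mat_adjoint (mat_adjoint B)) = dim_col B"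
    using mat_adjoint_carrier[OF d] by auto
  fix i j assume "i < dim_row B" "j < dim_col B"
  thus "mat_adjoint (mat_adjoint B) $$ (i, j) = B $$ (i, j)"
    using d by (simp add: mat_adjoint_index)
qed

lemma conjugate_scalar_prod_swap:
  fixes v w :: "'a :: conjugatable_field vec"
  assumes "v \<in> carrier_vec n" "w \<in> carrier_vec n"
  shows "conjugate (v \<bullet> w) = conjugate w \<bullet> conjugate v"
  using conjugate_sprod_vec[OF assms] comm_scalar_prod[of "conjugate v" n "conjugate w"] assms
  by simp

lemma row_mat_adjoint:
  assumes "i < dim_col B"
  shows "row (mat_adjoint B) i = conjugate (col B i)"
  using assms mat_adjoint_carrier[of B "dim_row B" "dim_col B"]
  by (intro eq_vecI) (auto simp: mat_adjoint_index)

lemma col_mat_adjoint: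
  assumes "i < dim_row B"
  shows "col (mat_adjoint B) i = conjugate (row B i)"
  using assms mat_adjoint_carrier[of B "dim_row B" "dim_col B"]
  by (intro eq_vecI) (auto simp: mat_adjoint_index)

lemma mat_adjoint_mult:
  assumes B: "B \<in> carrier_mat nr n" and C: "C \<in> carrier_mat n nc"
  shows "mat_adjoint (B * C) = mat_adjoint C * mat_adjoint B"
proof (rule eq_matI)
  note B' = mat_adjoint_carrier[OF B] and C' = mat_adjoint_carrier[OF C]
  have BC: "mat_adjoint (B * C) \<in> carrier_mat nc nr"
    by (rule mat_adjoint_carrier) (use B C in auto)
  show "dim_row (mat_adjoint (B * C)) = dim_row (mat_adjoint C * mat_adjoint B)"
    "dim_col (mat_adjoint (B * C)) = dim_col (mat_adjoint C * mat_adjoint B)"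
    using BC B' C' by auto
  fix i j
  assume "i < dim_row (mat_adjoint C * mat_adjoint B)" "j < dim_col (mat_adjoint C * mat_adjoint B)"
  hence ij: "i < nc" "j < nr" using B' C' by auto
  have "mat_adjoint (B * C) $$ (i, j) = conjugate (row B j \<bullet> col C i)"
    using ij B C by (simp add: mat_adjoint_index)
  also have "\<dots> = conjugate (col C i) \<bullet> conjugate (row B j)"
    by (rule conjugate_scalar_prod_swap[of _ n]) (use B C in auto)
  also have "\<dots> = (mat_adjoint C * mat_adjoint B) $$ (i, j)"
    using ij B C B' C' by (simp add: row_mat_adjoint col_mat_adjoint)
  finally show "mat_adjoint (B * C) $$ (i, j) = (mat_adjoint C * mat_adjoint B) $$ (i, j)" .
qed

lemma mat_adjoint_mult_vec_scalar_prod: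
  assumes B: "B \<in> carrier_mat nr nc" and u: "u \<in> carrier_vec nr" and v: "v \<in> carrier_vec nc"
  shows "(mat_adjoint B *\<^sub>v u) \<bullet>c v = u \<bullet>c (B *\<^sub>v v)"
proof -
  have adj: "mat_adjoint B = (map_mat conjugate B)\<^sup>T"
    using mat_adjoint_carrier[OF B] B by (intro eq_matI) (auto simp: mat_adjoint_index)
  have conj: "map_mat conjugate B *\<^sub>v conjugate v = conjugate (B *\<^sub>v v)"
  proof (rule eq_vecI)
    fix i assume "i < dim_vec (conjugate (B *\<^sub>v v))"
    hence i: "i < nr" using B by simp
    have "row (map_mat conjugate B) i = conjugate (row B i)"
      using i B by (intro eq_vecI) auto
    thus "(map_mat conjugate B *\<^sub>v conjugate v) $ i = conjugate (B *\<^sub>v v) $ i"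
      using i B v conjugate_sprod_vec[of "row B i" nc v] by simp
  qed (use B in simp)
  show ?thesis
    unfolding adj conj[symmetric]
    by (rule transpose_vec_mult_scalar[of _ nr nc]) (use B u v in auto)
qed

section \<open>Matrices of full column rank\<close>

text \<open>
  Linear independence of the set of columns says something about the kernel only when no column
  is repeated. Repetition is excluded here by counting: the rank
  is the size of some independent set of columns, so \<open>nc\<close> columns of rank \<open>nc\<close> are distinct.
\<close>

lemma (in vec_space) full_col_rank_kernel_trivial:
  assumes B: "B \<in> carrier_mat n nc" and rk: "rank B = nc"
    and v: "v \<in> carrier_vec nc" "B *\<^sub>v v = 0\<^sub>v n"
  shows "v = 0\<^sub>v nc"
proof (rule ccontr)
  assume "v \<noteq> 0\<^sub>v nc"
  obtain S where S: "maximal S (\<lambda>T. T \<subseteq> set (cols B) \<and> lin_indpt T)"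
    using maximal_exists[of "\<lambda>T. T \<subseteq> set (cols B) \<and> lin_indpt T" "card (set (cols B))" "{}"]
    by (meson List.finite_set card_mono empty_iff empty_subsetI finite_lin_indpt2 rev_finite_subset)
  have "card S \<le> card (set (cols B))"
    using S by (intro card_mono) (auto simp: maximal_def)
  hence "length (cols B) \<le> card (set (cols B))"
    using rank_card_indpt[OF B S] rk B by simp
  hence dist: "distinct (cols B)"
    using card_length[of "cols B"] by (intro card_distinct) simp
  show False
    using lin_depI[OF B v(1) \<open>v \<noteq> 0\<^sub>v nc\<close> v(2) dist] full_rank_lin_indpt[OF B rk dist] by blast
qed

lemma full_col_rank_inj_on:
  assumes B: "B \<in> carrier_mat nr nc" and rk: "vec_space.rank nr B = nc"
  shows "inj_on (\<lambda>v. B *\<^sub>v v) (carrier_vec nc)"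
proof (rule inj_onI)
  fix u v assume u: "u \<in> carrier_vec nc" and v: "v \<in> carrier_vec nc" and eq: "B *\<^sub>v u = B *\<^sub>v v"
  have "B *\<^sub>v (u - v) = 0\<^sub>v nr"
    using mult_minus_distrib_mat_vec[OF B u v] eq B v by simp
  hence "u - v = 0\<^sub>v nc"
    using vec_space.full_col_rank_kernel_trivial[OF B rk] u v by simp
  show "u = v"
  proof (rule eq_vecI)
    fix i assume "i < dim_vec v"
    thus "u $ i = v $ i"
      using arg_cong[OF \<open>u - v = 0\<^sub>v nc\<close>, of "\<lambda>w. w $ i"] u v by simp
  qed (use u v in simp)
qed

section \<open>The Moore--Penrose pseudoinverse\<close>

text \<open>
  The products \<open>B X\<close> and \<open>B Y\<close> are the same orthogonal projection, onto the column space of \<open>B\<close>.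
  Each absorbs the other from the left, and taking adjoints turns one of these absorptions around.
\<close>

lemma pseudoinverse_left_products_eq:
  assumes B: "B \<in> carrier_mat nr nc" and X: "X \<in> carrier_mat nc nr" and Y: "Y \<in> carrier_mat nc nr"
    and BXB: "B * X * B = B" and BYB: "B * Y * B = B"
    and hX: "mat_adjoint (B * X) = B * X" and hY: "mat_adjoint (B * Y) = B * Y"
  shows "B * X = B * Y"
proof -
  have BX: "B * X \<in> carrier_mat nr nr" and BY: "B * Y \<in> carrier_mat nr nr" using B X Y by auto
  have "B * X = (B * Y) * (B * X)"
    using assoc_mult_mat[OF BY B X] BYB by simp
  hence "mat_adjoint (B * X) = mat_adjoint (B * X) * mat_adjoint (B * Y)"
    using mat_adjoint_mult[OF BY BX] by simp
  also have "\<dots> = (B * X) * (B * Y)" by (simp add: hX hY)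
  also have "\<dots> = B * Y" using assoc_mult_mat[OF BX B Y] BXB by simp
  finally show ?thesis by (simp add: hX)
qed

text \<open>
  The adjoint of a pseudoinverse of \<open>B\<close> is a pseudoinverse of the adjoint of \<open>B\<close>, which turns
  equality of the products \<open>B X\<close> into equality of the products \<open>X B\<close>. Both together force \<open>X = Y\<close>.
\<close>

lemma is_pseudoinverse_unique:
  assumes "is_pseudoinverse B X" and "is_pseudoinverse B Y"
  shows "X = Y"
proof -
  let ?r = "dim_row B" and ?c = "dim_col B"
  have B: "B \<in> carrier_mat ?r ?c" by simp
  have X: "X \<in> carrier_mat ?c ?r" and X1: "B * X * B = B" and X2: "X * B * X = X"
    and X3: "mat_adjoint (B * X) = B * X" and X4: "mat_adjoint (X * B) = X * B"
    using assms(1) unfolding is_pseudoinverse_def by auto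
  have Y: "Y \<in> carrier_mat ?c ?r" and Y1: "B * Y * B = B" and Y2: "Y * B * Y = Y"
    and Y3: "mat_adjoint (B * Y) = B * Y" and Y4: "mat_adjoint (Y * B) = Y * B"
    using assms(2) unfolding is_pseudoinverse_def by auto
  note B' = mat_adjoint_carrier[OF B]
  have adj: "mat_adjoint B * mat_adjoint Z = Z * B"
    "Z * B * mat_adjoint B = mat_adjoint B"
    if Z: "Z \<in> carrier_mat ?c ?r" and "B * Z * B = B" "mat_adjoint (Z * B) = Z * B" for Z
  proof -
    show "mat_adjoint B * mat_adjoint Z = Z * B"
      using mat_adjoint_mult[OF Z B] that(3) by simp
    have "mat_adjoint (B * (Z * B)) = mat_adjoint (Z * B) * mat_adjoint B"
      by (rule mat_adjoint_mult[OF B]) (use Z in auto)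
    thus "Z * B * mat_adjoint B = mat_adjoint B"
      using assoc_mult_mat[OF B Z B] that(2,3) by simp
  qed
  have left: "B * X = B * Y"
    by (rule pseudoinverse_left_products_eq[OF B X Y X1 Y1 X3 Y3])
  have "mat_adjoint B * mat_adjoint X = mat_adjoint B * mat_adjoint Y"
    by (rule pseudoinverse_left_products_eq[OF B' mat_adjoint_carrier[OF X] mat_adjoint_carrier[OF Y]])
      (simp_all add: adj[OF X X1 X4] adj[OF Y Y1 Y4] X4 Y4)
  hence right: "X * B = Y * B"
    by (simp add: adj(1)[OF X X1 X4] adj(1)[OF Y Y1 Y4])
  have "X = Y * B * X" using X2 right by simp
  also have "\<dots> = Y * (B * Y)" using assoc_mult_mat[OF Y B X] left by simp
  also have "\<dots> = Y" using assoc_mult_mat[OF Y B Y] Y2 by simp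
  finally show ?thesis .
qed

text \<open>
  If \<open>B\<^sup>* B v = 0\<close>, then pairing with \<open>v\<close> gives \<open>\<langle>B v, B v\<rangle> = 0\<close>, hence \<open>B v = 0\<close>.
\<close>

lemma gram_matrix_det_nonzero:
  fixes B :: "'a :: conjugatable_ordered_field mat"
  assumes B: "B \<in> carrier_mat nr nc" and inj: "inj_on (\<lambda>v. B *\<^sub>v v) (carrier_vec nc)"
  shows "det (mat_adjoint B * B) \<noteq> 0"
proof
  note B' = mat_adjoint_carrier[OF B]
  assume "det (mat_adjoint B * B) = 0"
  then obtain v where v: "v \<in> carrier_vec nc" "v \<noteq> 0\<^sub>v nc" and 0: "(mat_adjoint B * B) *\<^sub>v v = 0\<^sub>v nc"
    using det_0_iff_vec_prod_zero_field[of "mat_adjoint B * B" nc] B B' by auto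
  have Bv: "B *\<^sub>v v \<in> carrier_vec nr" using B v by simp
  have "(B *\<^sub>v v) \<bullet>c (B *\<^sub>v v) = (mat_adjoint B *\<^sub>v (B *\<^sub>v v)) \<bullet>c v"
    by (rule mat_adjoint_mult_vec_scalar_prod[OF B Bv v(1), symmetric])
  also have "\<dots> = 0"
    using 0 assoc_mult_mat_vec[OF B' B v(1)] v(1) by simp
  finally have "B *\<^sub>v v = 0\<^sub>v nr" using Bv by simp
  also have "\<dots> = B *\<^sub>v 0\<^sub>v nc" using B by (intro eq_vecI) auto
  finally have "v = 0\<^sub>v nc" using inj_onD[OF inj] v(1) by simp
  thus False using v(2) by simp
qed

lemma is_pseudoinverse_normal_equations:
  assumes B: "B \<in> carrier_mat nr nc" and G: "G \<in> carrier_mat nc nc"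
    and GL: "G * (mat_adjoint B * B) = 1\<^sub>m nc"
  shows "is_pseudoinverse B (G * mat_adjoint B)"
proof -
  note B' = mat_adjoint_carrier[OF B] and G' = mat_adjoint_carrier[OF G]
  let ?H = "mat_adjoint B * B"
  let ?X = "G * mat_adjoint B"
  have H: "?H \<in> carrier_mat nc nc" using B B' by simp
  have X: "?X \<in> carrier_mat nc nr" using G B' by simp
  have XB: "?X * B = 1\<^sub>m nc" using assoc_mult_mat[OF G B' B] GL by simp
  have adj_1: "mat_adjoint (1\<^sub>m nc :: complex mat) = 1\<^sub>m nc"
    using mat_adjoint_carrier[of "1\<^sub>m nc :: complex mat" nc nc]
    by (intro eq_matI) (auto simp: mat_adjoint_index)
  have H_herm: "mat_adjoint ?H = ?H"
    using mat_adjoint_mult[OF B' B] by (simp add: mat_adjoint_adjoint)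
  \<comment> \<open>An inverse of a Hermitian matrix is Hermitian: its adjoint is an inverse on the other side.\<close>
  have "?H * mat_adjoint G = 1\<^sub>m nc"
    using mat_adjoint_mult[OF G H] GL H_herm adj_1 by simp
  hence G_herm: "mat_adjoint G = G"
    using assoc_mult_mat[OF G H G'] GL G G' by simp
  have BX: "mat_adjoint (B * ?X) = B * ?X"
  proof -
    have "mat_adjoint (B * ?X) = mat_adjoint ?X * mat_adjoint B"
      by (rule mat_adjoint_mult[OF B X])
    also have "mat_adjoint ?X = B * G"
      using mat_adjoint_mult[OF G B'] G_herm by (simp add: mat_adjoint_adjoint)
    also have "B * G * mat_adjoint B = B * ?X" by (rule assoc_mult_mat[OF B G B'])
    finally show ?thesis .
  qed
  have "B * ?X * B = B" using assoc_mult_mat[OF B X B] XB B by simp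
  moreover have "?X * B * ?X = ?X" unfolding XB by (rule left_mult_one_mat[OF X])
  moreover have "mat_adjoint (?X * B) = ?X * B" using XB adj_1 by simp
  ultimately show ?thesis unfolding is_pseudoinverse_def using X B BX by auto
qed

lemma is_pseudoinverse_pseudoinverse:
  assumes B: "B \<in> carrier_mat nr nc" and inj: "inj_on (\<lambda>v. B *\<^sub>v v) (carrier_vec nc)"
  shows "is_pseudoinverse B (pseudoinverse B)"
proof -
  have H: "mat_adjoint B * B \<in> carrier_mat nc nc" using mat_adjoint_carrier[OF B] B by simp
  obtain G where "G \<in> carrier_mat nc nc" "G * (mat_adjoint B * B) = 1\<^sub>m nc"
    using det_non_zero_imp_unit[OF H gram_matrix_det_nonzero[OF B inj], of "()"]
    by (auto simp: Units_def ring_mat_simps)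
  hence "is_pseudoinverse B (G * mat_adjoint B)"
    by (rule is_pseudoinverse_normal_equations[OF B])
  thus ?thesis
    unfolding pseudoinverse_def by (rule theI)
      (rule is_pseudoinverse_unique[OF _ \<open>is_pseudoinverse B (G * mat_adjoint B)\<close>])
qed

lemma pseudoinverse_mult_vec:
  assumes B: "B \<in> carrier_mat nr nc" and inj: "inj_on (\<lambda>v. B *\<^sub>v v) (carrier_vec nc)"
    and c: "c \<in> carrier_vec nc"
  shows "pseudoinverse B *\<^sub>v (B *\<^sub>v c) = c"
proof -
  let ?X = "pseudoinverse B"
  have X: "?X \<in> carrier_mat nc nr" and BXB: "B * ?X * B = B"
    using is_pseudoinverse_pseudoinverse[OF B inj] B unfolding is_pseudoinverse_def by auto
  have Bc: "B *\<^sub>v c \<in> carrier_vec nr" using B c by simp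
  have "B *\<^sub>v (?X *\<^sub>v (B *\<^sub>v c)) = (B * ?X) *\<^sub>v (B *\<^sub>v c)"
    by (rule assoc_mult_mat_vec[OF B X Bc, symmetric])
  also have "\<dots> = (B * ?X * B) *\<^sub>v c"
    by (rule assoc_mult_mat_vec[OF _ B c, symmetric]) (use B X in auto)
  finally have "B *\<^sub>v (?X *\<^sub>v (B *\<^sub>v c)) = B *\<^sub>v c" by (simp add: BXB)
  thus ?thesis using inj_onD[OF inj] X Bc c by simp
qed

section \<open>Sampling and recovery of bandlimited signals\<close>

lemma select_cols_carrier:
  assumes "V \<in> carrier_mat n n" "\<Omega> \<subseteq> {..<n}"
  shows "select_cols V \<Omega> \<in> carrier_mat n (card \<Omega>)"
proof -
  have "{j. j < n \<and> j \<in> \<Omega>} = \<Omega>" using assms(2) by auto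
  thus ?thesis using assms(1) by (intro carrier_matI) (simp_all add: select_cols_def dim_submatrix)
qed

lemma restriction_mat_carrier:
  assumes "M \<subseteq> {..<n}"
  shows "restriction_mat n M \<in> carrier_mat (card M) n"
proof -
  have "{i. i < n \<and> i \<in> M} = M" using assms by auto
  thus ?thesis by (intro carrier_matI) (simp_all add: restriction_mat_def dim_submatrix)
qed

lemma bandlimited_iff:
  assumes "select_cols V \<Omega> \<in> carrier_mat n k"
  shows "bandlimited n V \<Omega> z \<longleftrightarrow> (\<exists>d \<in> carrier_vec k. z = select_cols V \<Omega> *\<^sub>v d)"
  using assms unfolding bandlimited_def vec_space.col_space_eq[OF assms] by auto

theorem theorem4p3:
  fixes n K m :: nat
    and A V V_inv \<Lambda> :: "complex mat"
    and \<Omega> M :: "nat set"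
    and x c y :: "complex vec"
  assumes "A \<in> carrier_mat n n"
    and "similar_mat_wit A \<Lambda> V V_inv"
    and "diagonal_mat \<Lambda>"
    and "\<Omega> \<subseteq> {..<n}" and "card \<Omega> = K"
    and "M \<subseteq> {..<n}" and "card M = m"
    and "c \<in> carrier_vec K" and "x = select_cols V \<Omega> *\<^sub>v c"
    and "vec_space.rank m (restriction_mat n M * select_cols V \<Omega>) = K"
    and "y = restriction_mat n M *\<^sub>v x"
  shows "bandlimited n V \<Omega> x
    \<and> (\<forall>z. bandlimited n V \<Omega> z \<and> restriction_mat n M *\<^sub>v z = y \<longrightarrow> z = x)
    \<and> (let c_hat = pseudoinverse (restriction_mat n M * select_cols V \<Omega>) *\<^sub>v y;
           x_hat = select_cols V \<Omega> *\<^sub>v c_hat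
       in x_hat = x)"
proof -
  let ?W = "select_cols V \<Omega>" and ?P = "restriction_mat n M"
  let ?B = "?P * ?W"
  have "V \<in> carrier_mat n n" by (rule similar_mat_witD2(6)[OF assms(1,2)])
  hence W: "?W \<in> carrier_mat n K" using select_cols_carrier[of V n \<Omega>] assms(4,5) by simp
  have P: "?P \<in> carrier_mat m n" using restriction_mat_carrier[of M n] assms(6,7) by simp
  have B: "?B \<in> carrier_mat m K" using P W by simp
  have inj: "inj_on (\<lambda>v. ?B *\<^sub>v v) (carrier_vec K)"
    by (rule full_col_rank_inj_on[OF B assms(10)])
  have samples: "?P *\<^sub>v (?W *\<^sub>v d) = ?B *\<^sub>v d" if "d \<in> carrier_vec K" for d
    by (rule assoc_mult_mat_vec[OF P W that, symmetric])
  have y: "y = ?B *\<^sub>v c" using samples[OF assms(8)] assms(9,11) by simp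
  have "bandlimited n V \<Omega> x" using bandlimited_iff[OF W] assms(8,9) by blast
  moreover have "z = x" if z: "bandlimited n V \<Omega> z" "?P *\<^sub>v z = y" for z
  proof -
    obtain d where d: "d \<in> carrier_vec K" "z = ?W *\<^sub>v d" using z(1) bandlimited_iff[OF W] by blast
    have "?B *\<^sub>v d = ?B *\<^sub>v c" using samples[OF d(1)] d(2) z(2) y by simp
    hence "d = c" using inj_onD[OF inj] d(1) assms(8) by simp
    thus ?thesis using d(2) assms(9) by simp
  qed
  moreover have "?W *\<^sub>v (pseudoinverse ?B *\<^sub>v y) = x"
    using pseudoinverse_mult_vec[OF B inj assms(8)] y assms(9) by simp
  ultimately show ?thesis unfolding Let_def by blast
qed

end
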